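(* Let $p(z)$ be a distribution over text prompts $z$. Suppose $p_{\mathrm{pre}}(x_{0:T}\mid z)$ and $p_\theta(x_{0:T}\mid z)$ are Markov chains conditioned on the text prompt $z$ that both start at $x_T\sim\mathcal{N}(0,I)$. Then $$\mathbb{E}_{p(z)}\Big[\mathrm{KL}\big(p_\theta(x_0\mid z)\,\big\|\,p_{\mathrm{pre}}(x_0\mid z)\big)\Big]\;\le\;\mathbb{E}_{p(z)}\left[\sum_{t=1}^{T}\mathbb{E}_{p_\theta(x_t\mid z)}\Big[\mathrm{KL}\big(p_\theta(x_{t-1}\mid x_t,z)\,\big\|\,p_{\mathrm{pre}}(x_{t-1}\mid x_t,z)\big)\Big]\right].$$
   Context: Here $x_0,\dots,x_T\in\mathbb{R}^n$, $x_{0:T}=(x_0,\dots,x_T)$, and the chains run backward in the index, from $x_T$ to $x_0$: for $p\in\{p_\theta,p_{\mathrm{pre}}\}$, the joint density is $p(x_{0:T}\mid z)=p(x_T)\prod_{t=1}^T p(x_{t-1}\mid x_t,z)$ with $p(x_T)=\mathcal{N}(0,I)$. $p(x_t\mid z)$ denotes the marginal law of $x_t$ under $p(\cdot\mid z)$; in particular $p(x_0\mid z)=\int p(x_{0:T}\mid z)\,dx_{1:T}$. $\mathrm{KL}(p\|q)=\int p\log(p/q)$ is the Kullback–Leibler divergence. ($p_{\mathrm{pre}}$ is the pre-trained diffusion model and $p_\theta$ the fine-tuned one.) *)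

theory Defs
  imports "HOL-Probability.Probability"
begin

text \<open>
  \<open>kl_div P Q\<close> is \<open>KL(P || Q)\<close> with values in \<open>[0, \<infinity>]\<close>, natural logarithm.  The library's
  \<^const>\<open>KL_divergence\<close> takes the reference measure first and is a Bochner integral, so it is
  meaningful only if \<open>P << Q\<close> and \<open>ln (dP/dQ)\<close> is \<open>P\<close>-integrable.  For probability measures
  the negative part of \<open>ln (dP/dQ)\<close> always has a finite \<open>P\<close>-integral; hence in all remaining cases
  the divergence is \<open>\<infinity>\<close> (with the usual convention \<open>p ln (p/0) = \<infinity>\<close> for \<open>p > 0\<close>).  For measures
  with densities \<open>p\<close>, \<open>q\<close> the finite value is \<open>\<integral> p ln (p/q)\<close>, see \<open>KL_density_density\<close>.
\<close>
definition kl_div :: "'a measure \<Rightarrow> 'a measure \<Rightarrow> ennreal" where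
  "kl_div P Q =
    (if absolutely_continuous Q P \<and> integrable P (entropy_density (exp 1) Q P)
     then ennreal (KL_divergence (exp 1) Q P) else \<infinity>)"

text \<open>Density of \<open>N(0, I)\<close>: the coordinates are independent standard normals.\<close>
definition std_normal_vec_density :: "real ^ 'n \<Rightarrow> real" where
  "std_normal_vec_density x = (\<Prod>i\<in>UNIV. std_normal_density (x $ i))"

text \<open>
  A family \<open>k\<close> encodes the (time-inhomogeneous, prompt-conditioned) backward transition densities:
  \<open>k t z x y\<close> is the density of \<open>x\<^sub>t\<^sub>-\<^sub>1\<close> at \<open>y\<close> given \<open>x\<^sub>t = x\<close> and the prompt \<open>z\<close>, for
  \<open>1 \<le> t \<le> T\<close>.  Joint measurability makes all expectations below well defined.
\<close>
definition backward_transitions ::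
  "'z measure \<Rightarrow> nat \<Rightarrow> (nat \<Rightarrow> 'z \<Rightarrow> real ^ 'n \<Rightarrow> real ^ 'n \<Rightarrow> real) \<Rightarrow> bool" where
  "backward_transitions Z T k \<longleftrightarrow>
    (\<forall>t\<in>{1..T}.
      (\<lambda>(z, x, y). k t z x y) \<in> borel_measurable (Z \<Otimes>\<^sub>M borel \<Otimes>\<^sub>M borel) \<and>
      (\<forall>z\<in>space Z. \<forall>x. (\<forall>y. 0 \<le> k t z x y) \<and> (\<integral>\<^sup>+ y. ennreal (k t z x y) \<partial>lborel) = 1))"

definition transition_law ::
  "(nat \<Rightarrow> 'z \<Rightarrow> real ^ 'n \<Rightarrow> real ^ 'n \<Rightarrow> real) \<Rightarrow> nat \<Rightarrow> 'z \<Rightarrow> real ^ 'n \<Rightarrow> (real ^ 'n) measure" where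
  "transition_law k t z x = density lborel (\<lambda>y. ennreal (k t z x y))"

text \<open>A path \<open>x\<^sub>0, \<dots>, x\<^sub>T\<close> is an extensional function on \<open>{0..T}\<close>; the chain runs from
  \<open>x\<^sub>T \<sim> N(0, I)\<close> down to \<open>x\<^sub>0\<close>.\<close>
definition path_density ::
  "nat \<Rightarrow> (nat \<Rightarrow> 'z \<Rightarrow> real ^ 'n \<Rightarrow> real ^ 'n \<Rightarrow> real) \<Rightarrow> 'z \<Rightarrow> (nat \<Rightarrow> real ^ 'n) \<Rightarrow> real" where
  "path_density T k z xs =
    std_normal_vec_density (xs T) * (\<Prod>t=1..T. k t z (xs t) (xs (t - 1)))"

definition path_law ::
  "nat \<Rightarrow> (nat \<Rightarrow> 'z \<Rightarrow> real ^ 'n \<Rightarrow> real ^ 'n \<Rightarrow> real) \<Rightarrow> 'z \<Rightarrow> (nat \<Rightarrow> real ^ 'n) measure" where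
  "path_law T k z =
    density (\<Pi>\<^sub>M t\<in>{0..T}. lborel) (\<lambda>xs. ennreal (path_density T k z xs))"

definition marginal_law ::
  "nat \<Rightarrow> (nat \<Rightarrow> 'z \<Rightarrow> real ^ 'n \<Rightarrow> real ^ 'n \<Rightarrow> real) \<Rightarrow> nat \<Rightarrow> 'z \<Rightarrow> (real ^ 'n) measure" where
  "marginal_law T k t z = distr (path_law T k z) lborel (\<lambda>xs. xs t)"

end

theory Submission
  imports Defs
begin

text \<open>
  The inequality holds for every prompt separately.  For probability densities the divergence is
  the integral of the nonnegative function \<open>h a b = a ln (a / b) - a + b\<close>, so that finite and
  infinite divergences can be treated alike.  As \<open>h a b\<close> is the supremum over \<open>s\<close> of
  \<open>a s - b (e\<^sup>s - 1)\<close>, it satisfies \<open>h (\<integral>f) (\<integral>g) \<le> \<integral>h f g\<close>: passing from the joint law of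
  \<open>(x\<^sub>t, x\<^sub>t\<^sub>-\<^sub>1)\<close> to the law of \<open>x\<^sub>t\<^sub>-\<^sub>1\<close> does not increase the divergence.  The divergence of the
  joint laws is that of the laws of \<open>x\<^sub>t\<close> plus the mean divergence of the transitions, and
  induction from \<open>T\<close>, where both chains agree, down to \<open>0\<close> gives the claim.
\<close>

section \<open>The pointwise integrand of the divergence\<close>

text \<open>The value is junk if an argument is infinite; the densities below are finite almost everywhere.\<close>
definition kl_integrand :: "ennreal \<Rightarrow> ennreal \<Rightarrow> ennreal" where
  "kl_integrand a b =
    (if b = 0 then (if a = 0 then 0 else \<infinity>)
     else ennreal (enn2real a * ln (enn2real a / enn2real b) - enn2real a + enn2real b))"

lemma kl_integrand_real:
  "0 \<le> a \<Longrightarrow> 0 < b \<Longrightarrow> kl_integrand (ennreal a) (ennreal b) = ennreal (a * ln (a / b) - a + b)"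
  by (simp add: kl_integrand_def)

text \<open>The product covers both branches, because \<open>\<infinity> * 0 = 0\<close> in
  \<open>ennreal\<close>; as a constant multiple of \<open>a\<close> it is integrated
  directly.\<close>

lemma kl_integrand_zero_right: "kl_integrand a 0 = \<infinity> * a"
  by (simp add: kl_integrand_def ennreal_top_mult)

lemma kl_integrand_zero_left: "b \<noteq> \<infinity> \<Longrightarrow> kl_integrand 0 b = b"
  by (cases b) (auto simp: kl_integrand_def)

lemma kl_integrand_refl: "kl_integrand a a = 0"
  by (cases a) (auto simp: kl_integrand_def)

lemma measurable_kl_integrand[measurable (raw)]:
  assumes [measurable]: "f \<in> borel_measurable M" "g \<in> borel_measurable M"
  shows "(\<lambda>x. kl_integrand (f x) (g x)) \<in> borel_measurable M"
  unfolding kl_integrand_def by measurable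

section \<open>Variational lower bound and log-sum inequality\<close>

text \<open>For \<open>a > 0\<close> this is \<open>ln u \<le> u - 1\<close> at
  \<open>u = b * exp s / a\<close>, multiplied by \<open>a\<close>. Equality holds at
  \<open>s = ln (a / b)\<close>.\<close>

lemma fenchel_young_real:
  fixes a b s :: real
  assumes "0 \<le> a" "0 < b"
  shows "a * s + a \<le> a * ln (a / b) + b * exp s"
proof (cases "a = 0")
  case False
  with assms have a: "0 < a" by simp
  have "ln (b * exp s / a) \<le> b * exp s / a - 1"
    using a assms by (intro ln_le_minus_one) auto
  moreover have "ln (b * exp s / a) = s - ln (a / b)"
    using a assms by (simp add: ln_div ln_mult)
  ultimately have "a * (s - ln (a / b)) \<le> a * (b * exp s / a - 1)"
    using a by (intro mult_left_mono) auto
  also have "\<dots> = b * exp s - a" using a by (simp add: field_simps)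
  finally show ?thesis by (simp add: algebra_simps)
qed (use assms in auto)

text \<open>Ensures that \<open>ennreal\<close> does not truncate the integrand, so that real
  identities for it carry over.\<close>

lemma kl_integrand_real_nonneg:
  fixes a b :: real
  assumes "0 \<le> a" "0 < b"
  shows "0 \<le> a * ln (a / b) - a + b"
  using fenchel_young_real[OF assms, of 0] by simp

text \<open>The inequality \<open>a s - b (e\<^sup>s - 1) \<le> h a b\<close>, where \<open>a s\<close> is moved to the right if \<open>s < 0\<close>,
  so that nothing is subtracted in \<^typ>\<open>ennreal\<close>.\<close>
lemma fenchel_young_kl_integrand:
  assumes "a \<noteq> \<infinity>" "b \<noteq> \<infinity>"
  shows "a * ennreal s + b \<le> kl_integrand a b + b * ennreal (exp s) + a * ennreal (- s)"
proof (cases "b = 0")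
  case True
  then show ?thesis by (cases "a = 0") (auto simp: kl_integrand_def)
next
  case False
  from assms False obtain x y where xy: "a = ennreal x" "0 \<le> x" "b = ennreal y" "0 < y"
    by (metis ennreal_cases ennreal_less_zero_iff infinity_ennreal_def zero_less_iff_neq_zero)
  let ?h = "x * ln (x / y) - x + y"
  have h: "0 \<le> ?h" using xy by (intro kl_integrand_real_nonneg)
  have f: "x * s + y \<le> ?h + y * exp s" using fenchel_young_real[of x y s] xy by simp
  show ?thesis
  proof (cases "0 \<le> s")
    case True
    then have "a * ennreal s + b = ennreal (x * s + y)"
      using xy by (simp add: ennreal_mult ennreal_plus)
    also have "\<dots> \<le> ennreal (?h + y * exp s)" using f by (rule ennreal_leI)
    also have "\<dots> = kl_integrand a b + b * ennreal (exp s)"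
      using xy h by (simp add: ennreal_plus[symmetric] ennreal_mult[symmetric] kl_integrand_real del: ennreal_plus)
    finally show ?thesis using True by (simp add: ennreal_neg)
  next
    case False
    then have "b \<le> ennreal (?h + y * exp s + x * (- s))"
      using xy f by (auto intro!: ennreal_leI)
    also have "\<dots> = kl_integrand a b + b * ennreal (exp s) + a * ennreal (- s)"
      using xy h False mult_nonneg_nonneg[of x "-s"]
      by (simp only: xy kl_integrand_real ennreal_plus ennreal_mult add_nonneg_nonneg mult_nonneg_nonneg
          exp_ge_zero less_imp_le neg_0_le_iff_le not_le)
    finally show ?thesis using False by (simp add: ennreal_neg)
  qed
qed

text \<open>The pointwise Fenchel-Young bound is integrated with one constant \<open>s\<close>,
  chosen so that the bound is sharp for the two total masses.\<close>

lemma log_sum_inequality: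
  assumes [measurable]: "f \<in> borel_measurable M" "g \<in> borel_measurable M"
    and fin: "(\<integral>\<^sup>+x. f x \<partial>M) \<noteq> \<infinity>" "(\<integral>\<^sup>+x. g x \<partial>M) \<noteq> \<infinity>"
  shows "kl_integrand (\<integral>\<^sup>+x. f x \<partial>M) (\<integral>\<^sup>+x. g x \<partial>M) \<le> (\<integral>\<^sup>+x. kl_integrand (f x) (g x) \<partial>M)"
    (is "kl_integrand ?A ?B \<le> ?H")
proof -
  have f_fin: "AE x in M. f x \<noteq> \<infinity>" using fin by (intro nn_integral_PInf_AE) auto
  have g_fin: "AE x in M. g x \<noteq> \<infinity>" using fin by (intro nn_integral_PInf_AE) auto
  \<comment> \<open>The logarithm of \<open>?A / ?B\<close> makes sense only if both masses are
    positive. If \<open>?A = 0\<close>, both sides equal \<open>?B\<close>; if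
    \<open>?B = 0\<close>, both equal \<open>\<infinity> * ?A\<close>.\<close>
  consider "?A = 0" | "?B = 0" | "?A \<noteq> 0" "?B \<noteq> 0" "?H = \<infinity>" | "?A \<noteq> 0" "?B \<noteq> 0" "?H \<noteq> \<infinity>" by blast
  then show ?thesis
  proof cases
    case 1
    then have "AE x in M. f x = 0" by (simp add: nn_integral_0_iff_AE)
    with g_fin have "AE x in M. kl_integrand (f x) (g x) = g x"
      by eventually_elim (simp add: kl_integrand_zero_left)
    then have "?H = ?B" by (rule nn_integral_cong_AE)
    with 1 fin show ?thesis by (simp add: kl_integrand_zero_left)
  next
    case 2
    then have "AE x in M. g x = 0" by (simp add: nn_integral_0_iff_AE)
    then have "AE x in M. kl_integrand (f x) (g x) = \<infinity> * f x"
      by eventually_elim (simp add: kl_integrand_zero_right)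
    then have "?H = (\<integral>\<^sup>+x. \<infinity> * f x \<partial>M)" by (rule nn_integral_cong_AE)
    also have "\<dots> = \<infinity> * ?A" by (rule nn_integral_cmult) simp
    finally show ?thesis using 2 by (simp add: kl_integrand_zero_right)
  next
    case 3
    then show ?thesis by simp
  next
    case 4
    from 4 fin obtain a b where ab: "?A = ennreal a" "0 < a" "?B = ennreal b" "0 < b"
      by (metis ennreal_cases ennreal_less_zero_iff infinity_ennreal_def zero_less_iff_neq_zero)
    from 4 obtain h where h: "?H = ennreal h" "0 \<le> h"
      by (metis ennreal_cases infinity_ennreal_def)
    \<comment> \<open>The maximiser of \<open>a * s - b * (exp s - 1)\<close>; the maximum is the
      real value of \<open>kl_integrand ?A ?B\<close>.\<close>
    define s where "s = ln (a / b)"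
    have s: "b * exp s = a" using ab by (simp add: s_def)
    have "AE x in M. f x * ennreal s + g x \<le>
        kl_integrand (f x) (g x) + g x * ennreal (exp s) + f x * ennreal (- s)"
      using f_fin g_fin by eventually_elim (rule fenchel_young_kl_integrand)
    then have "(\<integral>\<^sup>+x. f x * ennreal s + g x \<partial>M) \<le>
        (\<integral>\<^sup>+x. kl_integrand (f x) (g x) + g x * ennreal (exp s) + f x * ennreal (- s) \<partial>M)"
      by (rule nn_integral_mono_AE)
    then have "?A * ennreal s + ?B \<le> ?H + ?B * ennreal (exp s) + ?A * ennreal (- s)"
      by (simp add: nn_integral_add nn_integral_multc)
    then have *: "ennreal a * ennreal s + ennreal b \<le>
        ennreal h + ennreal (b * exp s) + ennreal a * ennreal (- s)"
      using ab h by (simp add: ennreal_mult)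
    have "a * s - a + b \<le> h"
    \<comment> \<open>The sign of \<open>s\<close> decides which of \<open>ennreal s\<close> and
      \<open>ennreal (- s)\<close> vanishes; what is left is an inequality between nonnegative
      reals.\<close>
    proof (cases "0 \<le> s")
      case True
      with * ab h have "ennreal (a * s + b) \<le> ennreal (h + a)"
        unfolding s by (simp add: ennreal_neg ennreal_mult ennreal_plus)
      with ab h show ?thesis by (simp add: ennreal_le_iff del: ennreal_plus)
    next
      case False
      then have "0 \<le> a * (- s)" using ab by (intro mult_nonneg_nonneg) auto
      with False * ab h have "ennreal b \<le> ennreal (h + a + a * (- s))"
        unfolding s by (simp add: ennreal_neg ennreal_mult[symmetric] ennreal_plus[symmetric] del: ennreal_plus)
      with ab h \<open>0 \<le> a * (- s)\<close> show ?thesis by (simp add: ennreal_le_iff del: ennreal_plus)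
    qed
    then show ?thesis
      using ab h by (simp only: kl_integrand_real less_imp_le s_def ennreal_leI)
  qed
qed

text \<open>In fact an equality, namely the pointwise chain rule; the extra summands replace subtractions
  and cancel after integration.\<close>
lemma kl_integrand_mult:
  assumes "a \<noteq> \<infinity>" "b \<noteq> \<infinity>" "c \<noteq> \<infinity>" "d \<noteq> \<infinity>"
  shows "kl_integrand (a * c) (b * d) + a * d + b * c \<le>
    a * kl_integrand c d + kl_integrand a b * c + a * c + b * d"
proof -
  \<comment> \<open>If \<open>a\<close> or \<open>c\<close> is 0, both sides reduce to the same sum.
    If both are nonzero but \<open>b\<close> or \<open>d\<close> is 0, the right-hand side is
    infinite. Only the last case involves logarithms.\<close>
  consider "a = 0" | "c = 0" | "b = 0" "a \<noteq> 0" "c \<noteq> 0" | "d = 0" "a \<noteq> 0" "c \<noteq> 0" |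
      "a \<noteq> 0" "b \<noteq> 0" "c \<noteq> 0" "d \<noteq> 0" by blast
  then show ?thesis
  proof cases
    case 1
    with assms show ?thesis
      by (simp add: kl_integrand_zero_left ennreal_mult_eq_top_iff algebra_simps)
  next
    case 2
    with assms show ?thesis
      by (simp add: kl_integrand_zero_left ennreal_mult_eq_top_iff algebra_simps)
  next
    case 3
    then show ?thesis by (simp add: kl_integrand_zero_right ennreal_top_mult)
  next
    case 4
    then show ?thesis by (simp add: kl_integrand_zero_right ennreal_mult_top)
  next
    case 5
    with assms obtain x y u v where r: "a = ennreal x" "b = ennreal y" "c = ennreal u" "d = ennreal v"
      "0 < x" "0 < y" "0 < u" "0 < v"
      by (metis ennreal_cases ennreal_less_zero_iff infinity_ennreal_def zero_less_iff_neq_zero)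
    let ?h1 = "(x * u) * ln ((x * u) / (y * v)) - x * u + y * v"
    let ?h2 = "u * ln (u / v) - u + v"
    let ?h3 = "x * ln (x / y) - x + y"
    have nn: "0 \<le> ?h1" "0 \<le> ?h2" "0 \<le> ?h3"
      using r by (intro kl_integrand_real_nonneg; simp)+
    \<comment> \<open>The logarithm of \<open>(x * u) / (y * v)\<close> splits into those of
      \<open>x / y\<close> and \<open>u / v\<close>. Every summand is nonnegative, so the identity
      passes to \<open>ennreal\<close> term by term.\<close>
    have "?h1 + x * v + y * u = x * ?h2 + ?h3 * u + x * u + y * v"
      using r by (simp add: ln_mult ln_div algebra_simps)
    then have "ennreal (?h1 + x * v + y * u) = ennreal (x * ?h2 + ?h3 * u + x * u + y * v)"
      by (rule arg_cong)
    moreover have "ennreal (?h1 + x * v + y * u) = ennreal ?h1 + ennreal x * ennreal v + ennreal y * ennreal u"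
      using r nn by (simp only: ennreal_plus ennreal_mult less_imp_le mult_nonneg_nonneg add_nonneg_nonneg)
    moreover have "ennreal (x * ?h2 + ?h3 * u + x * u + y * v) =
        ennreal x * ennreal ?h2 + ennreal ?h3 * ennreal u + ennreal x * ennreal u + ennreal y * ennreal v"
      using r nn by (simp only: ennreal_plus ennreal_mult less_imp_le mult_nonneg_nonneg add_nonneg_nonneg)
    moreover have "kl_integrand (a * c) (b * d) = ennreal ?h1"
      using r by (simp only: kl_integrand_real ennreal_mult[symmetric] less_imp_le mult_nonneg_nonneg mult_pos_pos)
    moreover have "kl_integrand c d = ennreal ?h2" "kl_integrand a b = ennreal ?h3"
      using r by (simp_all only: kl_integrand_real less_imp_le)
    ultimately show ?thesis using r by simp
  qed
qed

section \<open>Divergence of densities\<close>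

text \<open>Homogeneity of degree one. It converts the integrand at the Radon-Nikodym derivative,
  integrated against the second law, into the integrand at two densities, integrated against their
  base measure.\<close>

lemma kl_integrand_scale:
  assumes "c \<noteq> 0" "c \<noteq> \<infinity>" "a \<noteq> \<infinity>"
  shows "kl_integrand (a * c) c = c * kl_integrand a 1"
proof -
  from assms obtain x y where r: "a = ennreal x" "0 \<le> x" "c = ennreal y" "0 < y"
    by (metis ennreal_cases ennreal_less_zero_iff infinity_ennreal_def zero_less_iff_neq_zero)
  have "kl_integrand (a * c) c = ennreal ((x * y) * ln ((x * y) / y) - x * y + y)"
    using r by (simp only: kl_integrand_real ennreal_mult[symmetric] less_imp_le mult_nonneg_nonneg)
  also have "(x * y) * ln ((x * y) / y) - x * y + y = y * (x * ln (x / 1) - x + 1)"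
    using r by (simp add: algebra_simps)
  also have "ennreal \<dots> = c * kl_integrand a (ennreal 1)"
    using r kl_integrand_real_nonneg[of x 1] by (simp only: kl_integrand_real ennreal_mult less_imp_le zero_less_one)
  finally show ?thesis by simp
qed

text \<open>The extra summand \<open>1 - r\<close> of the integrand has integral \<open>0\<close> and makes it nonnegative.\<close>
lemma kl_div_RN_deriv:
  assumes "prob_space P" "prob_space Q" and sets: "sets P = sets Q"
    and ac: "absolutely_continuous Q P"
  shows "kl_div P Q = (\<integral>\<^sup>+x. kl_integrand (RN_deriv Q P x) 1 \<partial>Q)"
proof -
  interpret P: prob_space P by fact
  interpret Q: prob_space Q by fact
  define r where "r x = enn2real (RN_deriv Q P x)" for x
  have r_meas[measurable]: "r \<in> borel_measurable Q" by (simp add: r_def[abs_def])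
  have r_nonneg: "0 \<le> r x" for x by (simp add: r_def)
  have r_AE: "AE x in Q. RN_deriv Q P x = ennreal (r x)"
    using Q.RN_deriv_finite[OF P.sigma_finite_measure_axioms ac sets]
    by eventually_elim (simp add: r_def less_top[symmetric])
  have "P = density Q (RN_deriv Q P)" using Q.density_RN_deriv[OF ac sets] by simp
  also have "\<dots> = density Q (\<lambda>x. ennreal (r x))"
    using r_AE by (intro density_cong) auto
  finally have P: "P = density Q (\<lambda>x. ennreal (r x))" .
  have "(\<integral>\<^sup>+x. ennreal (r x) \<partial>Q) = 1"
    using P.emeasure_space_1 by (subst (asm) P, subst (asm) P) (simp add: emeasure_density cong: nn_integral_cong)
  then have r_int: "integrable Q r" "integral\<^sup>L Q r = 1"
    using r_nonneg by (auto intro!: integrableI_nonneg simp: integral_eq_nn_integral)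
  let ?\<phi> = "\<lambda>x. r x * ln (r x) - r x + 1"
  have \<phi>_nonneg: "0 \<le> ?\<phi> x" for x
    using kl_integrand_real_nonneg[of "r x" 1] r_nonneg[of x] by simp
  \<comment> \<open>An equality at every point, not just almost everywhere, since
    \<open>kl_integrand\<close> itself applies \<open>enn2real\<close>.\<close>
  have H: "(\<integral>\<^sup>+x. kl_integrand (RN_deriv Q P x) 1 \<partial>Q) = (\<integral>\<^sup>+x. ennreal (?\<phi> x) \<partial>Q)"
    by (simp add: kl_integrand_def r_def)
  have ed: "entropy_density (exp 1) Q P = (\<lambda>x. ln (r x))"
    by (auto simp: entropy_density_def r_def fun_eq_iff log_def)
  have int_iff: "integrable P (\<lambda>x. ln (r x)) \<longleftrightarrow> integrable Q (\<lambda>x. r x * ln (r x))"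
    by (subst P, subst integrable_real_density) (use r_nonneg in auto)
  have kl: "KL_divergence (exp 1) Q P = (\<integral>x. r x * ln (r x) \<partial>Q)"
    unfolding KL_divergence_def ed
    by (subst P, subst integral_real_density) (use r_nonneg in auto)
  show ?thesis
  proof (cases "integrable Q (\<lambda>x. r x * ln (r x))")
    case True
    then have "integrable Q ?\<phi>" using r_int by auto
    then have "(\<integral>\<^sup>+x. ennreal (?\<phi> x) \<partial>Q) = ennreal (\<integral>x. ?\<phi> x \<partial>Q)"
      by (rule nn_integral_eq_integral) (use \<phi>_nonneg in auto)
    also have "(\<integral>x. ?\<phi> x \<partial>Q) = (\<integral>x. r x * ln (r x) \<partial>Q)"
      using True r_int by (simp add: Q.prob_space)
    finally show ?thesis unfolding H kl_div_def ed int_iff kl using True ac by simp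
  next
    case False
    \<comment> \<open>Adding the integrable function \<open>r - 1\<close> to \<open>?\<phi>\<close>
      would make \<open>r * ln r\<close> integrable. As \<open>?\<phi>\<close> is nonnegative, its
      integral is then \<open>\<infinity>\<close>, matching the default value of
      \<open>kl_div\<close>.\<close>
    have "\<not> integrable Q ?\<phi>"
    proof
      assume \<phi>_int: "integrable Q ?\<phi>"
      have "integrable Q (\<lambda>x. r x - 1)"
        by (rule Bochner_Integration.integrable_diff[OF r_int(1) Q.integrable_const])
      from Bochner_Integration.integrable_add[OF \<phi>_int this] have "integrable Q (\<lambda>x. r x * ln (r x))"
        by (simp only: diff_add_cancel add_diff_cancel_left' add_diff_cancel_right' diff_add_eq add_diff_eq)
      with False show False by (rule notE)
    qed
    moreover have "integrable Q ?\<phi>" if "(\<integral>\<^sup>+x. ennreal (?\<phi> x) \<partial>Q) < \<infinity>"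
      by (rule integrableI_nonneg[OF _ _ that]) (measurable, rule AE_I2, rule \<phi>_nonneg)
    ultimately have "(\<integral>\<^sup>+x. ennreal (?\<phi> x) \<partial>Q) = \<infinity>"
      by (metis infinity_ennreal_def less_top)
    then show ?thesis unfolding H kl_div_def ed int_iff using False by simp
  qed
qed

text \<open>Absorbs the case distinction in \<open>kl_div\<close>: from here on divergences are
  plain nonnegative integrals. With absolute continuity, \<open>f\<close> is \<open>g\<close> times
  the Radon-Nikodym derivative and homogeneity applies; without it, both sides are infinite.\<close>

lemma (in sigma_finite_measure) kl_div_density:
  assumes f[measurable]: "f \<in> borel_measurable M" and g[measurable]: "g \<in> borel_measurable M"
    and int: "(\<integral>\<^sup>+x. f x \<partial>M) = 1" "(\<integral>\<^sup>+x. g x \<partial>M) = 1"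
  shows "kl_div (density M f) (density M g) = (\<integral>\<^sup>+x. kl_integrand (f x) (g x) \<partial>M)"
proof -
  let ?P = "density M f" and ?Q = "density M g"
  have P: "prob_space ?P" and Q: "prob_space ?Q"
    using int by (auto intro!: prob_spaceI simp: emeasure_density cong: nn_integral_cong)
  interpret Q: prob_space ?Q by fact
  show ?thesis
  proof (cases "absolutely_continuous ?Q ?P")
    case True
    define \<rho> where "\<rho> = RN_deriv ?Q ?P"
    have \<rho>[measurable]: "\<rho> \<in> borel_measurable M"
      using borel_measurable_RN_deriv[of ?Q ?P] by (simp add: \<rho>_def)
    have "density M (\<lambda>x. g x * \<rho> x) = density ?Q \<rho>"
      by (simp add: density_density_eq)
    also have "\<dots> = ?P" unfolding \<rho>_def using True by (intro Q.density_RN_deriv) auto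
    finally have f_AE: "AE x in M. g x * \<rho> x = f x"
      by (intro density_unique) auto
    have g_fin: "AE x in M. g x \<noteq> \<infinity>" using int by (intro nn_integral_PInf_AE) auto
    \<comment> \<open>Finiteness is known up to \<open>?Q\<close>-null sets, hence in terms of
      \<open>M\<close> only where \<open>g\<close> is positive.\<close>
    have "AE x in ?Q. \<rho> x \<noteq> \<infinity>"
      unfolding \<rho>_def using True P by (intro Q.RN_deriv_finite prob_space_imp_sigma_finite) auto
    then have \<rho>_fin: "AE x in M. 0 < g x \<longrightarrow> \<rho> x \<noteq> \<infinity>" by (simp add: AE_density)
    have "kl_div ?P ?Q = (\<integral>\<^sup>+x. kl_integrand (\<rho> x) 1 \<partial>?Q)"
      unfolding \<rho>_def using P Q True by (intro kl_div_RN_deriv) auto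
    also have "\<dots> = (\<integral>\<^sup>+x. g x * kl_integrand (\<rho> x) 1 \<partial>M)"
      by (rule nn_integral_density) auto
    also have "\<dots> = (\<integral>\<^sup>+x. kl_integrand (f x) (g x) \<partial>M)"
    proof (rule nn_integral_cong_AE)
      show "AE x in M. g x * kl_integrand (\<rho> x) 1 = kl_integrand (f x) (g x)"
        using f_AE g_fin \<rho>_fin
      proof eventually_elim
        case (elim x)
        \<comment> \<open>Where \<open>g x = 0\<close>, the equation
          \<open>g x * \<rho> x = f x\<close> gives \<open>f x = 0\<close>, and both sides are
          0.\<close>
        then show ?case
          using kl_integrand_scale[of "g x" "\<rho> x"]
          by (cases "g x = 0") (auto simp: kl_integrand_refl zero_less_iff_neq_zero mult.commute)
      qed
    qed
    finally show ?thesis .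
  next
    case False
    have "(\<integral>\<^sup>+x. kl_integrand (f x) (g x) \<partial>M) = \<infinity>"
    proof (rule ccontr)
      assume "\<not> ?thesis"
      then have "AE x in M. kl_integrand (f x) (g x) \<noteq> \<infinity>"
        by (intro nn_integral_PInf_AE) auto
      \<comment> \<open>The integrand is infinite where \<open>g\<close> vanishes and
        \<open>f\<close> does not, so a finite integral would force absolute continuity.\<close>
      then have "AE x in M. g x = 0 \<longrightarrow> f x = 0"
        by eventually_elim (auto simp: kl_integrand_def split: if_splits)
      then have "null_sets ?Q \<subseteq> null_sets ?P"
        by (auto simp: null_sets_density_iff elim: AE_mp)
      with False show False by (simp add: absolutely_continuous_def)
    qed
    with False show ?thesis by (simp add: kl_div_def)
  qed
qed

section \<open>Divergence across one transition\<close>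

text \<open>Here \<open>f\<close>, \<open>g\<close> are the densities of the current state and
  \<open>k\<close>, \<open>l\<close> the transition densities, so the left-hand side is the
  divergence of the laws of the next state. The log-sum inequality over \<open>x\<close> bounds it
  by the divergence of the joint laws; the pointwise chain rule, integrated over \<open>y\<close>,
  splits the latter.\<close>

lemma (in sigma_finite_measure) kl_chain_step:
  assumes [measurable]: "f \<in> borel_measurable M" "g \<in> borel_measurable M"
    "case_prod k \<in> borel_measurable (M \<Otimes>\<^sub>M M)" "case_prod l \<in> borel_measurable (M \<Otimes>\<^sub>M M)"
    and int: "(\<integral>\<^sup>+x. f x \<partial>M) = 1" "(\<integral>\<^sup>+x. g x \<partial>M) = 1"
    and k: "\<And>x. x \<in> space M \<Longrightarrow> (\<integral>\<^sup>+y. k x y \<partial>M) = 1" 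
    and l: "\<And>x. x \<in> space M \<Longrightarrow> (\<integral>\<^sup>+y. l x y \<partial>M) = 1"
  shows "(\<integral>\<^sup>+y. kl_integrand (\<integral>\<^sup>+x. f x * k x y \<partial>M) (\<integral>\<^sup>+x. g x * l x y \<partial>M) \<partial>M)
    \<le> (\<integral>\<^sup>+x. kl_integrand (f x) (g x) \<partial>M) + (\<integral>\<^sup>+x. f x * (\<integral>\<^sup>+y. kl_integrand (k x y) (l x y) \<partial>M) \<partial>M)"
proof -
  interpret MM: pair_sigma_finite M M ..
  \<comment> \<open>A normalised kernel preserves total mass. The mixtures are therefore finite
    almost everywhere, as the log-sum inequality requires.\<close>
  have total: "(\<integral>\<^sup>+y. (\<integral>\<^sup>+x. u x * w x y \<partial>M) \<partial>M) = (\<integral>\<^sup>+x. u x \<partial>M)"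
    if [measurable]: "u \<in> borel_measurable M" "case_prod w \<in> borel_measurable (M \<Otimes>\<^sub>M M)"
      and w: "\<And>x. x \<in> space M \<Longrightarrow> (\<integral>\<^sup>+y. w x y \<partial>M) = 1" for u w
  proof -
    have "(\<integral>\<^sup>+y. (\<integral>\<^sup>+x. u x * w x y \<partial>M) \<partial>M) = (\<integral>\<^sup>+x. (\<integral>\<^sup>+y. u x * w x y \<partial>M) \<partial>M)"
      by (rule MM.Fubini') measurable
    also have "\<dots> = (\<integral>\<^sup>+x. u x \<partial>M)"
      by (intro nn_integral_cong) (simp add: nn_integral_cmult w)
    finally show ?thesis .
  qed
  have fk: "AE y in M. (\<integral>\<^sup>+x. f x * k x y \<partial>M) \<noteq> \<infinity>"
    by (rule nn_integral_PInf_AE) (use total[of f k] k int in auto)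
  have gl: "AE y in M. (\<integral>\<^sup>+x. g x * l x y \<partial>M) \<noteq> \<infinity>"
    by (rule nn_integral_PInf_AE) (use total[of g l] l int in auto)
  have "(\<integral>\<^sup>+y. kl_integrand (\<integral>\<^sup>+x. f x * k x y \<partial>M) (\<integral>\<^sup>+x. g x * l x y \<partial>M) \<partial>M)
      \<le> (\<integral>\<^sup>+y. (\<integral>\<^sup>+x. kl_integrand (f x * k x y) (g x * l x y) \<partial>M) \<partial>M)"
  proof (rule nn_integral_mono_AE)
    show "AE y in M. kl_integrand (\<integral>\<^sup>+x. f x * k x y \<partial>M) (\<integral>\<^sup>+x. g x * l x y \<partial>M)
        \<le> (\<integral>\<^sup>+x. kl_integrand (f x * k x y) (g x * l x y) \<partial>M)"
      using fk gl AE_space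
    proof eventually_elim
      case (elim y)
      then have [measurable]: "y \<in> space M" by simp
      show ?case using elim by (intro log_sum_inequality) auto
    qed
  qed
  also have "\<dots> = (\<integral>\<^sup>+x. (\<integral>\<^sup>+y. kl_integrand (f x * k x y) (g x * l x y) \<partial>M) \<partial>M)"
    by (rule MM.Fubini') measurable
  also have "\<dots> \<le> (\<integral>\<^sup>+x. kl_integrand (f x) (g x) + f x * (\<integral>\<^sup>+y. kl_integrand (k x y) (l x y) \<partial>M) \<partial>M)"
  proof (rule nn_integral_mono_AE)
    have "AE x in M. f x \<noteq> \<infinity>" "AE x in M. g x \<noteq> \<infinity>"
      by (rule nn_integral_PInf_AE; simp add: int)+
    then show "AE x in M. (\<integral>\<^sup>+y. kl_integrand (f x * k x y) (g x * l x y) \<partial>M)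
        \<le> kl_integrand (f x) (g x) + f x * (\<integral>\<^sup>+y. kl_integrand (k x y) (l x y) \<partial>M)"
      using AE_space
    proof eventually_elim
      case (elim x)
      then have x[measurable]: "x \<in> space M" by simp
      let ?H = "\<integral>\<^sup>+y. kl_integrand (f x * k x y) (g x * l x y) \<partial>M"
      let ?K = "\<integral>\<^sup>+y. kl_integrand (k x y) (l x y) \<partial>M"
      have "AE y in M. k x y \<noteq> \<infinity>" "AE y in M. l x y \<noteq> \<infinity>"
        by (rule nn_integral_PInf_AE; simp add: k[OF x] l[OF x])+
      then have "AE y in M. kl_integrand (f x * k x y) (g x * l x y) + f x * l x y + g x * k x y
          \<le> f x * kl_integrand (k x y) (l x y) + kl_integrand (f x) (g x) * k x y + f x * k x y + g x * l x y"
        by eventually_elim (use elim in \<open>intro kl_integrand_mult\<close>)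
      then have "(\<integral>\<^sup>+y. kl_integrand (f x * k x y) (g x * l x y) + f x * l x y + g x * k x y \<partial>M)
          \<le> (\<integral>\<^sup>+y. f x * kl_integrand (k x y) (l x y) + kl_integrand (f x) (g x) * k x y
              + f x * k x y + g x * l x y \<partial>M)"
        by (rule nn_integral_mono_AE)
      \<comment> \<open>Both kernels integrate to 1, so the summands standing in for subtractions
        become \<open>f x + g x\<close> on either side; these are finite and cancel.\<close>
      then have "?H + f x + g x \<le> f x * ?K + kl_integrand (f x) (g x) + f x + g x"
        by (simp add: nn_integral_add nn_integral_cmult k[OF x] l[OF x])
      then have "(f x + g x) + ?H \<le> (f x + g x) + (kl_integrand (f x) (g x) + f x * ?K)"
        by (simp add: ac_simps)
      with elim show ?case by (simp add: ennreal_add_left_cancel_le)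
    qed
  qed
  also have "\<dots> = (\<integral>\<^sup>+x. kl_integrand (f x) (g x) \<partial>M) + (\<integral>\<^sup>+x. f x * (\<integral>\<^sup>+y. kl_integrand (k x y) (l x y) \<partial>M) \<partial>M)"
    by (rule nn_integral_add) measurable
  finally show ?thesis .
qed

section \<open>Backward chains\<close>

text \<open>Joint density of the coordinates from \<open>s\<close> to \<open>T\<close>. With
  \<open>s = 0\<close> it is the density of the whole path; the parameter allows coordinates to be
  removed one at a time from the bottom.\<close>

definition path_weight ::
  "('a \<Rightarrow> ennreal) \<Rightarrow> (nat \<Rightarrow> 'a \<Rightarrow> 'a \<Rightarrow> ennreal) \<Rightarrow> nat \<Rightarrow> nat \<Rightarrow> (nat \<Rightarrow> 'a) \<Rightarrow> ennreal" where
  "path_weight f \<kappa> T s xs = f (xs T) * (\<Prod>t\<in>{Suc s..T}. \<kappa> t (xs t) (xs (t - 1)))"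

text \<open>The second number counts the steps taken from time \<open>T\<close> downwards.\<close>
primrec marginal_density ::
  "'a measure \<Rightarrow> ('a \<Rightarrow> ennreal) \<Rightarrow> (nat \<Rightarrow> 'a \<Rightarrow> 'a \<Rightarrow> ennreal) \<Rightarrow> nat \<Rightarrow> nat \<Rightarrow> 'a \<Rightarrow> ennreal" where
  "marginal_density M f \<kappa> T 0 = f"
| "marginal_density M f \<kappa> T (Suc n) = (\<lambda>y. \<integral>\<^sup>+x. marginal_density M f \<kappa> T n x * \<kappa> (T - n) x y \<partial>M)"

lemma path_weight_step:
  "s < T \<Longrightarrow> path_weight f \<kappa> T s xs = path_weight f \<kappa> T (Suc s) xs * \<kappa> (Suc s) (xs (Suc s)) (xs s)"
  by (simp add: path_weight_def prod.atLeast_Suc_atMost ac_simps)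

text \<open>The factors have \<open>t \<ge> Suc (Suc s)\<close> and so read no index below
  \<open>Suc s\<close>.\<close>

lemma path_weight_upd: "s < T \<Longrightarrow> path_weight f \<kappa> T (Suc s) (xs(s := y)) = path_weight f \<kappa> T (Suc s) xs"
  by (auto simp: path_weight_def intro!: arg_cong2[where f="(*)"] prod.cong)

text \<open>The chain over an arbitrary sigma-finite base measure, with start density
  \<open>f\<close> at time \<open>T\<close>. Values in \<open>ennreal\<close> let Tonelli's theorem
  apply without integrability conditions.\<close>

locale backward_chain = sigma_finite_measure M for M :: "'a measure" +
  fixes f :: "'a \<Rightarrow> ennreal" and \<kappa> :: "nat \<Rightarrow> 'a \<Rightarrow> 'a \<Rightarrow> ennreal" and T :: nat
  assumes f_measurable[measurable]: "f \<in> borel_measurable M"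
    and \<kappa>_measurable: "t \<in> {1..T} \<Longrightarrow> case_prod (\<kappa> t) \<in> borel_measurable (M \<Otimes>\<^sub>M M)"
    and f_total: "(\<integral>\<^sup>+x. f x \<partial>M) = 1"
    and \<kappa>_total: "t \<in> {1..T} \<Longrightarrow> x \<in> space M \<Longrightarrow> (\<integral>\<^sup>+y. \<kappa> t x y \<partial>M) = 1"
begin

interpretation MM: pair_sigma_finite M M ..

sublocale paths: product_sigma_finite "\<lambda>_::nat. M" ..

abbreviation marginal :: "nat \<Rightarrow> 'a \<Rightarrow> ennreal" where
  "marginal t \<equiv> marginal_density M f \<kappa> T (T - t)"

text \<open>The recursion in terms of time instead of steps taken: the kernel with index
  \<open>Suc s\<close> leads from time \<open>Suc s\<close> to time \<open>s\<close>.\<close>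

lemma marginal_step:
  assumes "s < T"
  shows "marginal s y = (\<integral>\<^sup>+x. marginal (Suc s) x * \<kappa> (Suc s) x y \<partial>M)"
proof -
  have "T - s = Suc (T - Suc s)" "T - (T - Suc s) = Suc s" using assms by auto
  then show ?thesis by simp
qed

lemma marginal_measurable: "s \<le> T \<Longrightarrow> marginal s \<in> borel_measurable M"
proof (induction rule: inc_induct)
  case (step s)
  note [measurable] = step.IH
  have [measurable]: "case_prod (\<kappa> (Suc s)) \<in> borel_measurable (M \<Otimes>\<^sub>M M)"
    using step by (intro \<kappa>_measurable) auto
  show ?case unfolding marginal_step[OF step.hyps(2), abs_def] by measurable
qed simp

lemma marginal_total: "s \<le> T \<Longrightarrow> (\<integral>\<^sup>+x. marginal s x \<partial>M) = 1"
proof (induction rule: inc_induct)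
  case (step s)
  have [measurable]: "case_prod (\<kappa> (Suc s)) \<in> borel_measurable (M \<Otimes>\<^sub>M M)"
    using step by (intro \<kappa>_measurable) auto
  have [measurable]: "marginal (Suc s) \<in> borel_measurable M"
    using step by (intro marginal_measurable) auto
  have "(\<integral>\<^sup>+y. marginal s y \<partial>M) = (\<integral>\<^sup>+y. (\<integral>\<^sup>+x. marginal (Suc s) x * \<kappa> (Suc s) x y \<partial>M) \<partial>M)"
    using marginal_step[OF step.hyps(2)] by simp
  also have "\<dots> = (\<integral>\<^sup>+x. (\<integral>\<^sup>+y. marginal (Suc s) x * \<kappa> (Suc s) x y \<partial>M) \<partial>M)"
    by (rule MM.Fubini') measurable
  also have "\<dots> = (\<integral>\<^sup>+x. marginal (Suc s) x \<partial>M)"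
    using step.hyps by (intro nn_integral_cong) (simp add: nn_integral_cmult \<kappa>_total)
  finally show ?case using step.IH by simp
qed (simp add: f_total)

section \<open>Coordinate laws of the path measure\<close>

lemma path_weight_measurable:
  assumes "s \<le> T"
  shows "path_weight f \<kappa> T s \<in> borel_measurable (Pi\<^sub>M {s..T} (\<lambda>_. M))"
proof -
  have "(\<lambda>xs. \<kappa> t (xs t) (xs (t - 1))) \<in> borel_measurable (Pi\<^sub>M {s..T} (\<lambda>_. M))"
    if t: "t \<in> {Suc s..T}" for t
  proof -
    have [measurable]: "case_prod (\<kappa> t) \<in> borel_measurable (M \<Otimes>\<^sub>M M)"
      using t by (intro \<kappa>_measurable) auto
    have [measurable]: "(\<lambda>xs. xs t) \<in> Pi\<^sub>M {s..T} (\<lambda>_. M) \<rightarrow>\<^sub>M M"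
      "(\<lambda>xs. xs (t - 1)) \<in> Pi\<^sub>M {s..T} (\<lambda>_. M) \<rightarrow>\<^sub>M M"
      using t by (auto intro!: measurable_component_singleton)
    show ?thesis by measurable
  qed
  moreover have "(\<lambda>xs. f (xs T)) \<in> borel_measurable (Pi\<^sub>M {s..T} (\<lambda>_. M))"
    using assms by (auto intro!: measurable_compose[OF _ f_measurable] measurable_component_singleton)
  ultimately show ?thesis
    unfolding path_weight_def[abs_def] by (intro borel_measurable_times_ennreal borel_measurable_prod_ennreal) auto
qed

text \<open>Tonelli with the lowest coordinate innermost: of the weight only the last kernel depends
  on it. The general \<open>H\<close> serves both for dropping that coordinate and for testing its
  law.\<close>

lemma nn_integral_path_step:
  assumes s: "s < T" and H: "H \<in> borel_measurable (Pi\<^sub>M {s..T} (\<lambda>_. M))"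
  shows "(\<integral>\<^sup>+xs. path_weight f \<kappa> T s xs * H xs \<partial>Pi\<^sub>M {s..T} (\<lambda>_. M)) =
    (\<integral>\<^sup>+xs. path_weight f \<kappa> T (Suc s) xs *
        (\<integral>\<^sup>+y. \<kappa> (Suc s) (xs (Suc s)) y * H (xs(s := y)) \<partial>M) \<partial>Pi\<^sub>M {Suc s..T} (\<lambda>_. M))"
proof -
  have ins: "{s..T} = insert s {Suc s..T}" using s by auto
  have "(\<integral>\<^sup>+xs. path_weight f \<kappa> T s xs * H xs \<partial>Pi\<^sub>M {s..T} (\<lambda>_. M)) =
    (\<integral>\<^sup>+xs. (\<integral>\<^sup>+y. path_weight f \<kappa> T s (xs(s := y)) * H (xs(s := y)) \<partial>M) \<partial>Pi\<^sub>M {Suc s..T} (\<lambda>_. M))"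
    unfolding ins
    by (rule paths.product_nn_integral_insert)
      (use s H path_weight_measurable[of s] in \<open>auto simp flip: ins\<close>)
  also have "\<dots> = (\<integral>\<^sup>+xs. path_weight f \<kappa> T (Suc s) xs *
        (\<integral>\<^sup>+y. \<kappa> (Suc s) (xs (Suc s)) y * H (xs(s := y)) \<partial>M) \<partial>Pi\<^sub>M {Suc s..T} (\<lambda>_. M))"
  proof (rule nn_integral_cong)
    fix xs assume xs: "xs \<in> space (Pi\<^sub>M {Suc s..T} (\<lambda>_. M))"
    then have x: "xs (Suc s) \<in> space M" using s by (auto simp: space_PiM)
    have [measurable]: "case_prod (\<kappa> (Suc s)) \<in> borel_measurable (M \<Otimes>\<^sub>M M)"
      using s by (intro \<kappa>_measurable) auto
    have [measurable]: "\<kappa> (Suc s) (xs (Suc s)) \<in> borel_measurable M"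
      using measurable_Pair2[OF \<open>case_prod (\<kappa> (Suc s)) \<in> _\<close> x] by simp
    have "(\<lambda>y. xs(s := y)) \<in> M \<rightarrow>\<^sub>M Pi\<^sub>M {s..T} (\<lambda>_. M)"
      unfolding ins by (rule measurable_component_update[OF xs]) simp
    from measurable_compose[OF this H]
    have [measurable]: "(\<lambda>y. H (xs(s := y))) \<in> borel_measurable M" .
    have "(\<integral>\<^sup>+y. path_weight f \<kappa> T s (xs(s := y)) * H (xs(s := y)) \<partial>M) =
      (\<integral>\<^sup>+y. path_weight f \<kappa> T (Suc s) xs * (\<kappa> (Suc s) (xs (Suc s)) y * H (xs(s := y))) \<partial>M)"
      using s by (simp add: path_weight_step path_weight_upd mult.assoc)
    then show "(\<integral>\<^sup>+y. path_weight f \<kappa> T s (xs(s := y)) * H (xs(s := y)) \<partial>M) =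
      path_weight f \<kappa> T (Suc s) xs * (\<integral>\<^sup>+y. \<kappa> (Suc s) (xs (Suc s)) y * H (xs(s := y)) \<partial>M)"
      by (simp add: nn_integral_cmult)
  qed
  finally show ?thesis .
qed

text \<open>The coordinates below \<open>t\<close> are integrated out from the bottom; each
  contributes the total mass 1 of its kernel.\<close>

lemma nn_integral_path_tail:
  assumes "t \<le> T" and [measurable]: "G \<in> borel_measurable M" and "s \<le> t"
  shows "(\<integral>\<^sup>+xs. path_weight f \<kappa> T s xs * G (xs t) \<partial>Pi\<^sub>M {s..T} (\<lambda>_. M)) =
    (\<integral>\<^sup>+xs. path_weight f \<kappa> T t xs * G (xs t) \<partial>Pi\<^sub>M {t..T} (\<lambda>_. M))"
  using \<open>s \<le> t\<close>
proof (induction rule: inc_induct)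
  case (step s)
  then have s: "s < T" using assms by simp
  have "(\<integral>\<^sup>+xs. path_weight f \<kappa> T s xs * G (xs t) \<partial>Pi\<^sub>M {s..T} (\<lambda>_. M)) =
    (\<integral>\<^sup>+xs. path_weight f \<kappa> T (Suc s) xs *
        (\<integral>\<^sup>+y. \<kappa> (Suc s) (xs (Suc s)) y * G ((xs(s := y)) t) \<partial>M) \<partial>Pi\<^sub>M {Suc s..T} (\<lambda>_. M))"
    using s step.hyps assms(1)
    by (intro nn_integral_path_step measurable_compose[OF _ assms(2)] measurable_component_singleton) auto
  also have "\<dots> = (\<integral>\<^sup>+xs. path_weight f \<kappa> T (Suc s) xs * G (xs t) \<partial>Pi\<^sub>M {Suc s..T} (\<lambda>_. M))"
  proof (intro nn_integral_cong arg_cong2[where f="(*)"] refl)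
    fix xs assume "xs \<in> space (Pi\<^sub>M {Suc s..T} (\<lambda>_. M))"
    then have x: "xs (Suc s) \<in> space M" using s by (auto simp: space_PiM)
    have "case_prod (\<kappa> (Suc s)) \<in> borel_measurable (M \<Otimes>\<^sub>M M)"
      using s by (intro \<kappa>_measurable) auto
    from measurable_Pair2[OF this x] have "\<kappa> (Suc s) (xs (Suc s)) \<in> borel_measurable M" by simp
    then show "(\<integral>\<^sup>+y. \<kappa> (Suc s) (xs (Suc s)) y * G ((xs(s := y)) t) \<partial>M) = G (xs t)"
      using step.hyps s x by (simp add: nn_integral_multc \<kappa>_total)
  qed
  finally show ?case using step.IH by simp
qed simp

text \<open>Integrates out the coordinates above \<open>s\<close>. The test function varies in the
  induction, since one step replaces \<open>G\<close> by its average under the kernel.\<close>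

lemma nn_integral_path_head:
  assumes "s \<le> T" and "G \<in> borel_measurable M"
  shows "(\<integral>\<^sup>+xs. path_weight f \<kappa> T s xs * G (xs s) \<partial>Pi\<^sub>M {s..T} (\<lambda>_. M)) = (\<integral>\<^sup>+x. marginal s x * G x \<partial>M)"
  using assms
proof (induction arbitrary: G rule: inc_induct)
  case base
  then show ?case
    using paths.product_nn_integral_singleton[of "\<lambda>x. f x * G x" T] by (simp add: path_weight_def)
next
  case (step s)
  note [measurable] = step.prems
  have [measurable]: "case_prod (\<kappa> (Suc s)) \<in> borel_measurable (M \<Otimes>\<^sub>M M)"
    using step by (intro \<kappa>_measurable) auto
  have [measurable]: "marginal (Suc s) \<in> borel_measurable M"
    using step by (intro marginal_measurable) auto
  have "(\<integral>\<^sup>+xs. path_weight f \<kappa> T s xs * G (xs s) \<partial>Pi\<^sub>M {s..T} (\<lambda>_. M)) =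
    (\<integral>\<^sup>+xs. path_weight f \<kappa> T (Suc s) xs *
        (\<integral>\<^sup>+y. \<kappa> (Suc s) (xs (Suc s)) y * G ((xs(s := y)) s) \<partial>M) \<partial>Pi\<^sub>M {Suc s..T} (\<lambda>_. M))"
    using step.hyps
    by (intro nn_integral_path_step measurable_compose[OF _ step.prems] measurable_component_singleton) auto
  also have "\<dots> = (\<integral>\<^sup>+x. marginal (Suc s) x * (\<integral>\<^sup>+y. \<kappa> (Suc s) x y * G y \<partial>M) \<partial>M)"
    using step.IH[of "\<lambda>x. \<integral>\<^sup>+y. \<kappa> (Suc s) x y * G y \<partial>M"] by simp
  also have "\<dots> = (\<integral>\<^sup>+x. (\<integral>\<^sup>+y. marginal (Suc s) x * \<kappa> (Suc s) x y * G y \<partial>M) \<partial>M)"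
    by (intro nn_integral_cong) (simp add: nn_integral_cmult[symmetric] mult.assoc)
  also have "\<dots> = (\<integral>\<^sup>+y. (\<integral>\<^sup>+x. marginal (Suc s) x * \<kappa> (Suc s) x y * G y \<partial>M) \<partial>M)"
    by (rule MM.Fubini'[symmetric]) measurable
  also have "\<dots> = (\<integral>\<^sup>+y. marginal s y * G y \<partial>M)"
    unfolding marginal_step[OF step.hyps(2)] by (intro nn_integral_cong nn_integral_multc) measurable
  finally show ?case .
qed

text \<open>Tested on indicators: the tail lemma removes the times below \<open>t\<close>, the head
  lemma those above.\<close>

lemma distr_path:
  assumes "t \<le> T"
  shows "distr (density (Pi\<^sub>M {0..T} (\<lambda>_. M)) (path_weight f \<kappa> T 0)) M (\<lambda>xs. xs t) = density M (marginal t)"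
    (is "distr ?D M _ = _")
proof (rule measure_eqI)
  fix A assume "A \<in> sets (distr ?D M (\<lambda>xs. xs t))"
  then have A[measurable]: "A \<in> sets M" by simp
  have comp[measurable]: "(\<lambda>xs. xs t) \<in> Pi\<^sub>M {0..T} (\<lambda>_. M) \<rightarrow>\<^sub>M M"
    using assms by (intro measurable_component_singleton) auto
  note [measurable] = path_weight_measurable[of 0, simplified] marginal_measurable[OF assms]
  have "emeasure (distr ?D M (\<lambda>xs. xs t)) A = (\<integral>\<^sup>+x. indicator A x \<partial>distr ?D M (\<lambda>xs. xs t))"
    by simp
  also have "\<dots> = (\<integral>\<^sup>+xs. indicator A (xs t) \<partial>?D)" by (rule nn_integral_distr) auto
  also have "\<dots> = (\<integral>\<^sup>+xs. path_weight f \<kappa> T 0 xs * indicator A (xs t) \<partial>Pi\<^sub>M {0..T} (\<lambda>_. M))"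
    by (rule nn_integral_density) auto
  also have "\<dots> = (\<integral>\<^sup>+x. marginal t x * indicator A x \<partial>M)"
    using nn_integral_path_tail[of t "indicator A" 0] nn_integral_path_head[of t "indicator A"] assms by simp
  also have "\<dots> = emeasure (density M (marginal t)) A" by (simp add: emeasure_density)
  finally show "emeasure (distr ?D M (\<lambda>xs. xs t)) A = emeasure (density M (marginal t)) A" .
qed simp

end

section \<open>Accumulation of the divergence along the chain\<close>

text \<open>Induction from \<open>T\<close> downwards. At \<open>T\<close> both chains have density
  \<open>f\<close>, so the divergence is 0; each step adds the mean divergence of one transition,
  weighted by the first chain.\<close>

lemma kl_backward_chain:
  assumes "backward_chain M f \<kappa> T" "backward_chain M f \<eta> T" and "s \<le> T"
  shows "(\<integral>\<^sup>+y. kl_integrand (marginal_density M f \<kappa> T (T - s) y) (marginal_density M f \<eta> T (T - s) y) \<partial>M)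
    \<le> (\<Sum>t\<in>{Suc s..T}. \<integral>\<^sup>+x. marginal_density M f \<kappa> T (T - t) x *
          (\<integral>\<^sup>+y. kl_integrand (\<kappa> t x y) (\<eta> t x y) \<partial>M) \<partial>M)"
  using \<open>s \<le> T\<close>
proof (induction rule: inc_induct)
  case base
  then show ?case by (simp add: kl_integrand_refl)
next
  case (step s)
  interpret P: backward_chain M f \<kappa> T by fact
  interpret Q: backward_chain M f \<eta> T by fact
  have "Suc s \<le> T" "Suc s \<in> {1..T}" using step by auto
  then have "(\<integral>\<^sup>+y. kl_integrand (P.marginal s y) (Q.marginal s y) \<partial>M)
    \<le> (\<integral>\<^sup>+y. kl_integrand (P.marginal (Suc s) y) (Q.marginal (Suc s) y) \<partial>M) +
      (\<integral>\<^sup>+x. P.marginal (Suc s) x * (\<integral>\<^sup>+y. kl_integrand (\<kappa> (Suc s) x y) (\<eta> (Suc s) x y) \<partial>M) \<partial>M)"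
    unfolding P.marginal_step[OF step.hyps(2)] Q.marginal_step[OF step.hyps(2)]
    by (intro P.kl_chain_step P.marginal_measurable Q.marginal_measurable P.marginal_total Q.marginal_total
        P.\<kappa>_measurable Q.\<kappa>_measurable P.\<kappa>_total Q.\<kappa>_total)
  also have "\<dots> \<le> (\<Sum>t\<in>{Suc (Suc s)..T}. \<integral>\<^sup>+x. P.marginal t x * (\<integral>\<^sup>+y. kl_integrand (\<kappa> t x y) (\<eta> t x y) \<partial>M) \<partial>M)
      + (\<integral>\<^sup>+x. P.marginal (Suc s) x * (\<integral>\<^sup>+y. kl_integrand (\<kappa> (Suc s) x y) (\<eta> (Suc s) x y) \<partial>M) \<partial>M)"
    by (intro add_right_mono step.IH)
  also have "\<dots> = (\<Sum>t\<in>{Suc s..T}. \<integral>\<^sup>+x. P.marginal t x * (\<integral>\<^sup>+y. kl_integrand (\<kappa> t x y) (\<eta> t x y) \<partial>M) \<partial>M)"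
    using \<open>Suc s \<le> T\<close> by (simp add: sum.atLeast_Suc_atMost[of "Suc s"] add.commute)
  finally show ?case .
qed

section \<open>Gaussian start and the concrete chains\<close>

lemma std_normal_vec_density_nonneg: "0 \<le> std_normal_vec_density x"
  by (auto simp: std_normal_vec_density_def intro!: prod_nonneg)

lemma std_normal_vec_density_measurable[measurable]:
  "(std_normal_vec_density :: real ^ 'n \<Rightarrow> real) \<in> borel_measurable borel"
proof -
  have [measurable]: "(\<lambda>x :: real ^ 'n. x $ i) \<in> borel_measurable borel" for i
    by (intro borel_measurable_continuous_onI continuous_intros)
  show ?thesis unfolding std_normal_vec_density_def[abs_def] by measurable
qed

lemma nn_integral_std_normal_vec_density:
  "(\<integral>\<^sup>+x. ennreal (std_normal_vec_density (x :: real ^ 'n)) \<partial>lborel) = 1"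
proof -
  \<comment> \<open>The density is a product over the index type, whereas
    \<open>nn_integral_lborel_prod\<close> uses \<open>Basis\<close>; the map from \<open>i\<close>
    to \<open>axis i 1\<close> identifies the two, and each factor integrates to 1.\<close>
  have Basis: "(Basis :: (real ^ 'n) set) = (\<lambda>i. axis i 1) ` UNIV"
    by (auto simp: Basis_vec_def)
  have inj: "inj (\<lambda>i :: 'n. axis i (1 :: real))" by (auto simp: inj_def axis_eq_axis)
  interpret N: prob_space "density lborel (\<lambda>x. ennreal (std_normal_density x))"
    by (rule prob_space_normal_density) simp
  have one: "(\<integral>\<^sup>+x. ennreal (std_normal_density x) \<partial>lborel) = 1"
    using N.emeasure_space_1 by (simp add: emeasure_density)
  have "ennreal (std_normal_vec_density x) = (\<Prod>b\<in>Basis. ennreal (std_normal_density (x \<bullet> b)))"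
    for x :: "real ^ 'n"
    unfolding std_normal_vec_density_def Basis prod.reindex[OF inj]
    by (simp add: prod_ennreal inner_axis)
  then have "(\<integral>\<^sup>+x. ennreal (std_normal_vec_density (x :: real ^ 'n)) \<partial>lborel) =
      (\<Prod>b\<in>(Basis :: (real ^ 'n) set). \<integral>\<^sup>+x. ennreal (std_normal_density x) \<partial>lborel)"
    using nn_integral_lborel_prod[of "\<lambda>_ :: real ^ 'n. \<lambda>x. ennreal (std_normal_density x)"] by simp
  then show ?thesis by (simp add: one)
qed

lemma backward_transitions_measurable:
  assumes "backward_transitions Z T k" "z \<in> space Z" "t \<in> {1..T}"
  shows "(\<lambda>(x, y). k t z x y) \<in> borel_measurable (borel \<Otimes>\<^sub>M borel)"
proof -
  have "(\<lambda>(z, x, y). k t z x y) \<in> borel_measurable (Z \<Otimes>\<^sub>M borel \<Otimes>\<^sub>M borel)"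
    using assms by (auto simp: backward_transitions_def)
  from measurable_Pair2[OF this assms(2)] show ?thesis by (simp add: case_prod_beta)
qed

lemma backward_chain_transitions:
  fixes k :: "nat \<Rightarrow> 'z \<Rightarrow> real ^ 'n \<Rightarrow> real ^ 'n \<Rightarrow> real"
  assumes "backward_transitions Z T k" "z \<in> space Z"
  shows "backward_chain lborel (\<lambda>x. ennreal (std_normal_vec_density x)) (\<lambda>t x y. ennreal (k t z x y)) T"
proof (unfold_locales)
  fix t assume "t \<in> {1..T}"
  then have [measurable]: "(\<lambda>(x, y). k t z x y) \<in> borel_measurable (lborel \<Otimes>\<^sub>M lborel)"
    using backward_transitions_measurable[OF assms] by (simp cong: measurable_cong_sets)
  show "(\<lambda>(x, y). ennreal (k t z x y)) \<in> borel_measurable (lborel \<Otimes>\<^sub>M lborel)" by measurable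
qed (use assms in \<open>auto simp: backward_transitions_def nn_integral_std_normal_vec_density\<close>)

text \<open>Connects the marginal defined through the path law with the recursive density to which
  the induction applies.\<close>

lemma marginal_law_eq_density:
  fixes k :: "nat \<Rightarrow> 'z \<Rightarrow> real ^ 'n \<Rightarrow> real ^ 'n \<Rightarrow> real"
  assumes k: "backward_transitions Z T k" and z: "z \<in> space Z" and t: "t \<le> T"
  shows "marginal_law T k t z = density lborel (marginal_density lborel
    (\<lambda>x. ennreal (std_normal_vec_density x)) (\<lambda>t x y. ennreal (k t z x y)) T (T - t))"
proof -
  interpret backward_chain lborel "\<lambda>x. ennreal (std_normal_vec_density x)" "\<lambda>t x y. ennreal (k t z x y)" T
    by (rule backward_chain_transitions[OF k z])
  \<comment> \<open>Nonnegativity allows \<open>ennreal\<close> to be moved inside the product of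
    kernels.\<close>
  have nonneg: "0 \<le> k t z x y" if "t \<in> {1..T}" for t x y
    using k z that by (auto simp: backward_transitions_def)
  have "ennreal (path_density T k z xs) =
      path_weight (\<lambda>x. ennreal (std_normal_vec_density x)) (\<lambda>t x y. ennreal (k t z x y)) T 0 xs" for xs
  proof -
    have "0 \<le> (\<Prod>t=1..T. k t z (xs t) (xs (t - 1)))" by (intro prod_nonneg) (auto intro: nonneg)
    moreover have "(\<Prod>t=1..T. ennreal (k t z (xs t) (xs (t - 1)))) =
        ennreal (\<Prod>t=1..T. k t z (xs t) (xs (t - 1)))"
      by (intro prod_ennreal nonneg)
    ultimately show ?thesis
      unfolding path_density_def path_weight_def
      by (simp add: ennreal_mult std_normal_vec_density_nonneg)
  qed
  then show ?thesis
    using distr_path[OF t] by (simp add: marginal_law_def path_law_def)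
qed

theorem lemma4p2:
  fixes Z :: "'z measure"
    and T :: nat
    and p_theta p_pre :: "nat \<Rightarrow> 'z \<Rightarrow> real ^ 'n \<Rightarrow> real ^ 'n \<Rightarrow> real"
  assumes "prob_space Z"
    and "backward_transitions Z T p_theta"
    and "backward_transitions Z T p_pre"
  shows "(\<integral>\<^sup>+ z. kl_div (marginal_law T p_theta 0 z) (marginal_law T p_pre 0 z) \<partial>Z)
    \<le> (\<integral>\<^sup>+ z. (\<Sum>t=1..T. \<integral>\<^sup>+ x. kl_div (transition_law p_theta t z x) (transition_law p_pre t z x)
                            \<partial>marginal_law T p_theta t z) \<partial>Z)"
proof (rule nn_integral_mono)
  \<comment> \<open>Monotonicity of the integral over prompts leaves an inequality for one fixed
    \<open>z\<close>.\<close>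
  fix z assume z: "z \<in> space Z"
  let ?f = "\<lambda>x :: real ^ 'n. ennreal (std_normal_vec_density x)"
  let ?p = "\<lambda>t x y. ennreal (p_theta t z x y)" and ?q = "\<lambda>t x y. ennreal (p_pre t z x y)"
  note P = backward_chain_transitions[OF assms(2) z]
  note Q = backward_chain_transitions[OF assms(3) z]
  interpret P: backward_chain lborel ?f ?p T by (rule P)
  interpret Q: backward_chain lborel ?f ?q T by (rule Q)
  have "kl_div (marginal_law T p_theta 0 z) (marginal_law T p_pre 0 z) =
      kl_div (density lborel (P.marginal 0)) (density lborel (Q.marginal 0))"
    by (simp add: marginal_law_eq_density[OF assms(2) z] marginal_law_eq_density[OF assms(3) z])
  also have "\<dots> = (\<integral>\<^sup>+y. kl_integrand (P.marginal 0 y) (Q.marginal 0 y) \<partial>lborel)"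
    by (intro lborel.kl_div_density P.marginal_measurable Q.marginal_measurable P.marginal_total Q.marginal_total) simp_all
  also have "\<dots> \<le> (\<Sum>t\<in>{Suc 0..T}. \<integral>\<^sup>+x. P.marginal t x *
      (\<integral>\<^sup>+y. kl_integrand (?p t x y) (?q t x y) \<partial>lborel) \<partial>lborel)"
    by (rule kl_backward_chain[OF P Q]) simp
  also have "\<dots> = (\<Sum>t=1..T. \<integral>\<^sup>+ x. kl_div (transition_law p_theta t z x) (transition_law p_pre t z x)
                            \<partial>marginal_law T p_theta t z)"
  proof (rule sum.cong)
    fix t assume t: "t \<in> {1..T}"
    note pm[measurable] = P.\<kappa>_measurable[OF t] and qm[measurable] = Q.\<kappa>_measurable[OF t]
    have [measurable]: "P.marginal t \<in> borel_measurable lborel"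
      using t by (intro P.marginal_measurable) simp
    \<comment> \<open>Holds for every \<open>x\<close>, since the kernels are normalised and have
      measurable sections at each point; it may thus be rewritten under the integral over the
      marginal law.\<close>
    have "kl_div (transition_law p_theta t z x) (transition_law p_pre t z x) =
        (\<integral>\<^sup>+y. kl_integrand (?p t x y) (?q t x y) \<partial>lborel)" for x
      unfolding transition_law_def
      using P.\<kappa>_total[OF t] Q.\<kappa>_total[OF t] measurable_Pair2[OF pm] measurable_Pair2[OF qm]
      by (intro lborel.kl_div_density) auto
    then have "(\<integral>\<^sup>+ x. kl_div (transition_law p_theta t z x) (transition_law p_pre t z x)
          \<partial>marginal_law T p_theta t z) =
        (\<integral>\<^sup>+x. (\<integral>\<^sup>+y. kl_integrand (?p t x y) (?q t x y) \<partial>lborel) \<partial>density lborel (P.marginal t))"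
      using t by (simp add: marginal_law_eq_density[OF assms(2) z])
    also have "\<dots> = (\<integral>\<^sup>+x. P.marginal t x * (\<integral>\<^sup>+y. kl_integrand (?p t x y) (?q t x y) \<partial>lborel) \<partial>lborel)"
      by (rule nn_integral_density) measurable
    finally show "(\<integral>\<^sup>+x. P.marginal t x * (\<integral>\<^sup>+y. kl_integrand (?p t x y) (?q t x y) \<partial>lborel) \<partial>lborel) =
        (\<integral>\<^sup>+ x. kl_div (transition_law p_theta t z x) (transition_law p_pre t z x)
          \<partial>marginal_law T p_theta t z)" by simp
  qed simp
  finally show "kl_div (marginal_law T p_theta 0 z) (marginal_law T p_pre 0 z)
    \<le> (\<Sum>t=1..T. \<integral>\<^sup>+ x. kl_div (transition_law p_theta t z x) (transition_law p_pre t z x)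
                            \<partial>marginal_law T p_theta t z)" .
qed

end
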